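(* Let $D\subset\mathbb{R}^2$ be open and let $f,\nu:D\to\mathbb{R}^4\setminus\{0\}$ be smooth with $\langle f,\nu\rangle=0$, related by the projective Lelieuvre map, i.e. $f\wedge f_x=\star(\nu\wedge\nu_x)$ and $f\wedge f_y=-\star(\nu\wedge\nu_y)$ on $D$. Assume that $\det|\nu,\nu_x,\nu_y,\nu_{xy}|$ and $\det|f,f_x,f_y,f_{xy}|$ vanish nowhere on $D$. Then $$f=\frac{[\nu,\nu_x,\nu_y]}{\sqrt{\det|\nu,\nu_x,\nu_y,\nu_{xy}|}},\qquad \nu=\frac{[f,f_x,f_y]}{\sqrt{\det|f,f_x,f_y,f_{xy}|}}$$ on $D$, where each square root denotes a suitably chosen one of the two square roots; that is, there exist functions $s,t:D\to\mathbb{R}$ with $s^2=\det|\nu,\nu_x,\nu_y,\nu_{xy}|$, $t^2=\det|f,f_x,f_y,f_{xy}|$, $f=s^{-1}[\nu,\nu_x,\nu_y]$ and $\nu=t^{-1}[f,f_x,f_y]$.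
   Context: $f=(f_1,\dots,f_4)$ and $\nu=(\nu_1,\dots,\nu_4)$ are homogeneous coordinate vectors of surfaces in $P^3$ and in the dual space $P_3$, depending on real variables $(x,y)$; subscripts $x,y$ denote partial derivatives; $\langle f,\nu\rangle=\sum_i f_i\nu_i$. $\varepsilon$ is the totally alternating symbol with $\varepsilon_{1234}=1$. For $a,b\in\mathbb{R}^4$, $(a\wedge b)_{ik}=a_ib_k-a_kb_i$; for a skew-symmetric $T$, $(\star T)_{ik}=\frac12\sum_{l,m}\varepsilon_{lmik}T_{lm}$. Thus the two equations of the map read $f_if_{k,x}-f_kf_{i,x}=\sum_{l,m}\varepsilon_{iklm}\nu_l\nu_{m,x}$ and $f_if_{k,y}-f_kf_{i,y}=-\sum_{l,m}\varepsilon_{iklm}\nu_l\nu_{m,y}$ for $i,k=1,\dots,4$. For $a,b,c\in\mathbb{R}^4$, $[a,b,c]_i=\sum_{j,k,l}\varepsilon_{ijkl}a_jb_kc_l$. $\det|a_1,a_2,a_3,a_4|$ is the determinant of the matrix formed by the four vectors. *)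

theory Defs
  imports "HOL-Analysis.Analysis"
begin

(* C^k on D, by recursion on directional derivatives of the Frechet derivative; meant for open D. *)
primrec Ck_on :: "nat \<Rightarrow> ('a::real_normed_vector \<Rightarrow> 'b::real_normed_vector) \<Rightarrow> 'a set \<Rightarrow> bool" where
  "Ck_on 0 f D \<longleftrightarrow> continuous_on D f"
| "Ck_on (Suc k) f D \<longleftrightarrow>
     (\<forall>p\<in>D. f differentiable (at p)) \<and> (\<forall>v. Ck_on k (\<lambda>p. frechet_derivative f (at p) v) D)"

definition smooth_on :: "('a::real_normed_vector \<Rightarrow> 'b::real_normed_vector) \<Rightarrow> 'a set \<Rightarrow> bool" where
  "smooth_on f D \<longleftrightarrow> (\<forall>k. Ck_on k f D)"

definition partial_x :: "(real \<times> real \<Rightarrow> 'b::real_normed_vector) \<Rightarrow> real \<times> real \<Rightarrow> 'b" where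
  "partial_x f p = vector_derivative (\<lambda>t. f (t, snd p)) (at (fst p))"

definition partial_y :: "(real \<times> real \<Rightarrow> 'b::real_normed_vector) \<Rightarrow> real \<times> real \<Rightarrow> 'b" where
  "partial_y f p = vector_derivative (\<lambda>t. f (fst p, t)) (at (snd p))"

(* The totally alternating symbol. In the index type 4 the numeral 4 coincides with 0, so
   1, 2, 3, 4 are its four elements and the updates of id below override every argument. *)
definition eps4 :: "4 \<Rightarrow> 4 \<Rightarrow> 4 \<Rightarrow> 4 \<Rightarrow> real" where
  "eps4 i j k l =
     (if distinct [i, j, k, l] then of_int (sign (id(1 := i, 2 := j, 3 := k, 4 := l))) else 0)"

definition wedge :: "real^4 \<Rightarrow> real^4 \<Rightarrow> real^4^4" where
  "wedge a b = (\<chi> i k. a $ i * b $ k - a $ k * b $ i)"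

definition hodge_star :: "real^4^4 \<Rightarrow> real^4^4" where
  "hodge_star T = (\<chi> i k. 1/2 * (\<Sum>l\<in>UNIV. \<Sum>m\<in>UNIV. eps4 l m i k * T $ l $ m))"

definition bracket3 :: "real^4 \<Rightarrow> real^4 \<Rightarrow> real^4 \<Rightarrow> real^4" where
  "bracket3 a b c =
     (\<chi> i. \<Sum>j\<in>UNIV. \<Sum>k\<in>UNIV. \<Sum>l\<in>UNIV. eps4 i j k l * a $ j * b $ k * c $ l)"

definition det4 :: "real^4 \<Rightarrow> real^4 \<Rightarrow> real^4 \<Rightarrow> real^4 \<Rightarrow> real" where
  "det4 a b c d = det (vector [a, b, c, d] :: real^4^4)"

definition projective_lelieuvre_on ::
  "(real \<times> real) set \<Rightarrow> (real \<times> real \<Rightarrow> real^4) \<Rightarrow> (real \<times> real \<Rightarrow> real^4) \<Rightarrow> bool" where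
  "projective_lelieuvre_on D f \<nu> \<longleftrightarrow>
     (\<forall>p\<in>D. wedge (f p) (partial_x f p) = hodge_star (wedge (\<nu> p) (partial_x \<nu> p)) \<and>
            wedge (f p) (partial_y f p) = - hodge_star (wedge (\<nu> p) (partial_y \<nu> p)))"

end

(* Contracting the equations of the map with \<nu> and differentiating <f, \<nu>> = 0 gives
   <f_x, \<nu>> = <f_y, \<nu>> = <f, \<nu>_x> = <f, \<nu>_y> = 0. Contracting the x-equation with \<nu>_y and the
   y-equation with \<nu>_x then gives [\<nu>, \<nu>_x, \<nu>_y] = s f with s = <f_x, \<nu>_y> = <f_y, \<nu>_x>, and the
   dual of the x-equation, contracted with f_y, gives [f, f_x, f_y] = s \<nu> with the same s.
   Differentiating <f, \<nu>_x> = 0 and <f_x, \<nu>> = 0 in y shows <f, \<nu>_xy> = <f_xy, \<nu>> = -s, so both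
   determinants equal s^2. *)

theory Submission
  imports Defs
begin

section \<open>Values of the alternating symbol\<close>

lemma eps4_swap:
  shows "eps4 j i k l = - eps4 i j k l" "eps4 i k j l = - eps4 i j k l" "eps4 i j l k = - eps4 i j k l"
proof -
  let ?p = "id(1 := i, 2 := j, 3 := k, 4 := l) :: 4 \<Rightarrow> 4"
  \<comment> \<open>Exchanging two neighbouring indices precomposes the index map \<open>?p\<close>
    with a transposition of positions. For distinct indices \<open>?p\<close> is injective on a
    finite type, hence a permutation, and the sign is multiplicative; for repeated indices both
    symbols are zero.\<close>
  have swap: "sign (?p \<circ> Transposition.transpose a b) = - sign ?p" if "distinct [i, j, k, l]" "a \<noteq> b" for a b
  proof -
    have "permutation p" if "inj p" for p :: "4 \<Rightarrow> 4"
      using that by (simp add: permutation bij_def finite_UNIV_inj_surj)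
    moreover have "inj ?p"
      unfolding inj_def using that(1) by (auto simp: forall_4)
    ultimately have "permutation ?p" .
    with that(2) show ?thesis
      by (simp add: sign_compose permutation_swap_id sign_swap_id)
  qed
  have "id(1 := j, 2 := i, 3 := k, 4 := l) = ?p \<circ> Transposition.transpose 1 2"
    by (simp add: fun_eq_iff forall_4 Transposition.transpose_def)
  moreover have "distinct [j, i, k, l] \<longleftrightarrow> distinct [i, j, k, l]"
    by auto
  ultimately show "eps4 j i k l = - eps4 i j k l"
    unfolding eps4_def using swap[of 1 2] by (simp only: if_distrib[of uminus] of_int_minus minus_zero) simp
  have "id(1 := i, 2 := k, 3 := j, 4 := l) = ?p \<circ> Transposition.transpose 2 3"
    by (simp add: fun_eq_iff forall_4 Transposition.transpose_def)
  moreover have "distinct [i, k, j, l] \<longleftrightarrow> distinct [i, j, k, l]"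
    by auto
  ultimately show "eps4 i k j l = - eps4 i j k l"
    unfolding eps4_def using swap[of 2 3] by (simp only: if_distrib[of uminus] of_int_minus minus_zero) simp
  have "id(1 := i, 2 := j, 3 := l, 4 := k) = ?p \<circ> Transposition.transpose 3 4"
    by (simp add: fun_eq_iff forall_4 Transposition.transpose_def)
  moreover have "distinct [i, j, l, k] \<longleftrightarrow> distinct [i, j, k, l]"
    by auto
  ultimately show "eps4 i j l k = - eps4 i j k l"
    unfolding eps4_def using swap[of 3 4] by (simp only: if_distrib[of uminus] of_int_minus minus_zero) simp
qed

lemma eps4_1234: "eps4 1 2 3 4 = 1"
proof -
  have "id(1 := 1, 2 := 2, 3 := 3, 4 := 4) = (id :: 4 \<Rightarrow> 4)"
    by (simp add: fun_eq_iff forall_4)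
  then show ?thesis by (simp add: eps4_def)
qed

lemma eps4_eq_0: "\<not> distinct [i, j, k, l] \<Longrightarrow> eps4 i j k l = 0"
  by (simp only: eps4_def if_False)

text \<open>Adjacent swaps generate all permutations of four indices, so the value at 1234 fixes the
  other 23. They are listed by increasing number of inversions, whose parity is the sign.\<close>

lemma eps4_perm_values:
  "eps4 2 1 3 4 = -1" "eps4 1 3 2 4 = -1" "eps4 1 2 4 3 = -1"
  "eps4 2 3 1 4 = 1" "eps4 3 1 2 4 = 1" "eps4 2 1 4 3 = 1" "eps4 1 3 4 2 = 1" "eps4 1 4 2 3 = 1"
  "eps4 3 2 1 4 = -1" "eps4 1 4 3 2 = -1" "eps4 2 3 4 1 = -1" "eps4 2 4 1 3 = -1"
  "eps4 3 1 4 2 = -1" "eps4 4 1 2 3 = -1"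
  "eps4 2 4 3 1 = 1" "eps4 3 2 4 1 = 1" "eps4 3 4 1 2 = 1" "eps4 4 1 3 2 = 1" "eps4 4 2 1 3 = 1"
  "eps4 3 4 2 1 = -1" "eps4 4 2 3 1 = -1" "eps4 4 3 1 2 = -1"
  "eps4 4 3 2 1 = 1"
  using eps4_swap eps4_1234 by metis+

lemmas eps4_values = eps4_1234 eps4_perm_values eps4_eq_0

section \<open>Contractions of bivectors, brackets and determinants\<close>

text \<open>The two terms of the wedge contribute equally, which absorbs the factor 1/2, and moving
  the free index to the front past two others is an even permutation. This turns the matrix
  equations of the map into vector equations.\<close>

lemma hodge_star_wedge_mult_vector: "hodge_star (wedge a b) *v c = bracket3 a b c"
  by (simp add: hodge_star_def wedge_def bracket3_def matrix_vector_mult_def vec_eq_iff forall_4 sum_4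
      eps4_values algebra_simps)

lemma minus_hodge_star_wedge_mult_vector: "(- hodge_star (wedge a b)) *v c = - bracket3 a b c"
  by (simp add: matrix_vector_mult_def vec_eq_iff sum_negf flip: hodge_star_wedge_mult_vector)

text \<open>The Euclidean star is an involution on bivectors in dimension 4. It serves to exchange
  the roles of f and \<nu> in the x-equation.\<close>

lemma hodge_star_hodge_star_wedge: "hodge_star (hodge_star (wedge a b)) = wedge a b"
  by (simp add: hodge_star_def wedge_def vec_eq_iff forall_4 sum_4 eps4_values algebra_simps)

lemma wedge_mult_vector_orthogonal:
  assumes "a \<bullet> c = 0"
  shows "wedge a b *v c = (b \<bullet> c) *\<^sub>R a"
proof -
  have "wedge a b *v c = (b \<bullet> c) *\<^sub>R a - (a \<bullet> c) *\<^sub>R b"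
    by (simp add: wedge_def matrix_vector_mult_def inner_vec_def vec_eq_iff forall_4 sum_4 algebra_simps)
  with assms show ?thesis by simp
qed

lemma vector_4:
  "(vector [a,b,c,d] :: 'a::zero^4) $ 1 = a" "(vector [a,b,c,d] :: 'a^4) $ 2 = b"
  "(vector [a,b,c,d] :: 'a^4) $ 3 = c" "(vector [a,b,c,d] :: 'a^4) $ 4 = d"
  unfolding vector_def by simp_all

lemma bracket3_same: "bracket3 a b a = 0"
  by (simp add: bracket3_def vec_eq_iff forall_4 sum_4 eps4_values)

lemma bracket3_swap: "bracket3 a c b = - bracket3 a b c"
  by (simp add: bracket3_def vec_eq_iff forall_4 sum_4 eps4_values)

text \<open>Expansion along the last row. The free index of \<open>bracket3\<close> stands first in
  the symbol, and moving it to the last place passes three others, whence the minus sign.\<close>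

lemma det4_eq_inner: "det4 a b c d = - (bracket3 a b c \<bullet> d)"
proof -
  \<comment> \<open>Side conditions for peeling off the indices 1, 2, 3 in turn, which expands the
    sum over permutations in \<open>det_def\<close> into its 24 terms.\<close>
  have insert1: "finite {2::4, 3, 4}" "1 \<notin> {2::4, 3, 4}"
    and insert2: "finite {3::4, 4}" "2 \<notin> {3::4, 4}"
    and insert3: "finite {4::4}" "3 \<notin> {4::4}"
    by auto
  have "bracket3 a b c \<bullet> d = - det4 a b c d"
    unfolding det4_def det_def UNIV_4
    unfolding sum_over_permutations_insert[OF insert1]
    unfolding sum_over_permutations_insert[OF insert2]
    unfolding sum_over_permutations_insert[OF insert3]
    unfolding permutes_sing
    by (simp add: sign_swap_id permutation_swap_id permutation_compose sign_compose
        Transposition.transpose_def vector_4)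
      (simp add: bracket3_def inner_vec_def sum_4 eps4_values algebra_simps)
  then show ?thesis by simp
qed

section \<open>Partial derivatives of smooth maps and of vanishing inner products\<close>

lemma partial_x_eq_frechet_derivative:
  assumes "f differentiable (at p)"
  shows "partial_x f p = frechet_derivative f (at p) (1, 0)"
proof -
  let ?f' = "frechet_derivative f (at p)"
  \<comment> \<open>The point is written as a pair to match the value at \<open>fst p\<close> of the
    horizontal line through it, as the chain rule requires.\<close>
  have f': "(f has_derivative ?f') (at (fst p, snd p))"
    using assms by (simp add: frechet_derivative_works)
  have "((\<lambda>t. (t, snd p)) has_derivative (\<lambda>h. (h, 0))) (at (fst p))"
    by (auto intro!: derivative_eq_intros)
  from has_derivative_compose[OF this f']
  have "((\<lambda>t. f (t, snd p)) has_derivative (\<lambda>h. ?f' (h, 0))) (at (fst p))" .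
  moreover have "(\<lambda>h. ?f' (h, 0)) = (\<lambda>h. h *\<^sub>R ?f' (1, 0))"
    by (simp flip: linear_scale[OF linear_frechet_derivative[OF assms]])
  ultimately show ?thesis
    unfolding partial_x_def
    by (simp only: vector_derivative_at has_vector_derivative_def)
qed

lemma partial_y_eq_frechet_derivative:
  assumes "f differentiable (at p)"
  shows "partial_y f p = frechet_derivative f (at p) (0, 1)"
proof -
  let ?f' = "frechet_derivative f (at p)"
  have f': "(f has_derivative ?f') (at (fst p, snd p))"
    using assms by (simp add: frechet_derivative_works)
  have "((\<lambda>t. (fst p, t)) has_derivative (\<lambda>h. (0, h))) (at (snd p))"
    by (auto intro!: derivative_eq_intros)
  from has_derivative_compose[OF this f']
  have "((\<lambda>t. f (fst p, t)) has_derivative (\<lambda>h. ?f' (0, h))) (at (snd p))" .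
  moreover have "(\<lambda>h. ?f' (0, h)) = (\<lambda>h. h *\<^sub>R ?f' (0, 1))"
    by (simp flip: linear_scale[OF linear_frechet_derivative[OF assms]])
  ultimately show ?thesis
    unfolding partial_y_def
    by (simp only: vector_derivative_at has_vector_derivative_def)
qed

lemma smooth_on_imp_differentiable:
  assumes "smooth_on f D" "p \<in> D"
  shows "f differentiable (at p)"
proof -
  have "Ck_on (Suc 0) f D" using assms(1) unfolding smooth_on_def by blast
  with assms(2) show ?thesis by simp
qed

text \<open>On D the partial derivative is the Frechet derivative in direction (1, 0), which is
  differentiable by the second-order condition; openness of D carries differentiability over. This
  justifies differentiating \<open>partial_x f\<close> in y.\<close>

lemma smooth_on_imp_partial_x_differentiable:
  assumes "open D" "smooth_on f D" "p \<in> D"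
  shows "partial_x f differentiable (at p)"
proof -
  have "Ck_on (Suc (Suc 0)) f D" using assms(2) unfolding smooth_on_def by blast
  then have "(\<lambda>q. frechet_derivative f (at q) (1, 0)) differentiable (at p)"
    using assms(3) by simp
  then obtain g' where "((\<lambda>q. frechet_derivative f (at q) (1, 0)) has_derivative g') (at p)"
    unfolding differentiable_def by blast
  then have "(partial_x f has_derivative g') (at p)"
    by (rule has_derivative_transform_within_open[OF _ assms(1,3)])
      (simp add: partial_x_eq_frechet_derivative smooth_on_imp_differentiable[OF assms(2)])
  then show ?thesis by (rule differentiableI)
qed

text \<open>The product rule gives one derivative of the inner product, and its vanishing on a
  neighbourhood of p gives the derivative 0; derivatives are unique.\<close>

lemma frechet_derivative_inner_eq_0:
  assumes "open D" "p \<in> D" and zero: "\<And>q. q \<in> D \<Longrightarrow> u q \<bullet> v q = 0"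
    and u: "u differentiable (at p)" and v: "v differentiable (at p)"
  shows "u p \<bullet> frechet_derivative v (at p) h + frechet_derivative u (at p) h \<bullet> v p = 0"
proof -
  have "((\<lambda>q. u q \<bullet> v q) has_derivative
      (\<lambda>h. u p \<bullet> frechet_derivative v (at p) h + frechet_derivative u (at p) h \<bullet> v p)) (at p)"
    using u v by (intro has_derivative_inner) (simp_all add: frechet_derivative_works)
  moreover have "((\<lambda>q. u q \<bullet> v q) has_derivative (\<lambda>h. 0)) (at p)"
    by (rule has_derivative_transform_within_open[OF has_derivative_const[of 0] assms(1,2)])
      (simp add: zero)
  ultimately show ?thesis
    by (rule has_derivative_unique[THEN fun_cong])
qed

lemma partial_x_inner_eq_0:
  assumes "open D" "p \<in> D" "\<And>q. q \<in> D \<Longrightarrow> u q \<bullet> v q = 0"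
    and "u differentiable (at p)" "v differentiable (at p)"
  shows "u p \<bullet> partial_x v p + partial_x u p \<bullet> v p = 0"
  using frechet_derivative_inner_eq_0[OF assms] assms(4,5)
  by (simp add: partial_x_eq_frechet_derivative)

lemma partial_y_inner_eq_0:
  assumes "open D" "p \<in> D" "\<And>q. q \<in> D \<Longrightarrow> u q \<bullet> v q = 0"
    and "u differentiable (at p)" "v differentiable (at p)"
  shows "u p \<bullet> partial_y v p + partial_y u p \<bullet> v p = 0"
  using frechet_derivative_inner_eq_0[OF assms] assms(4,5)
  by (simp add: partial_y_eq_frechet_derivative)

section \<open>Square-root formulas for surfaces related by the Lelieuvre map\<close>

theorem theorem2p1:
  fixes D :: "(real \<times> real) set" and f \<nu> :: "real \<times> real \<Rightarrow> real^4"
  assumes "open D"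
    and "smooth_on f D" and "smooth_on \<nu> D"
    and "\<forall>p\<in>D. f p \<noteq> 0" and "\<forall>p\<in>D. \<nu> p \<noteq> 0"
    and "\<forall>p\<in>D. f p \<bullet> \<nu> p = 0"
    and "projective_lelieuvre_on D f \<nu>"
    and "\<forall>p\<in>D. det4 (\<nu> p) (partial_x \<nu> p) (partial_y \<nu> p) (partial_y (partial_x \<nu>) p) \<noteq> 0"
    and "\<forall>p\<in>D. det4 (f p) (partial_x f p) (partial_y f p) (partial_y (partial_x f) p) \<noteq> 0"
  shows "\<exists>s t :: real \<times> real \<Rightarrow> real. \<forall>p\<in>D.
      (s p)\<^sup>2 = det4 (\<nu> p) (partial_x \<nu> p) (partial_y \<nu> p) (partial_y (partial_x \<nu>) p) \<and>
      (t p)\<^sup>2 = det4 (f p) (partial_x f p) (partial_y f p) (partial_y (partial_x f) p) \<and>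
      f p = inverse (s p) *\<^sub>R bracket3 (\<nu> p) (partial_x \<nu> p) (partial_y \<nu> p) \<and>
      \<nu> p = inverse (t p) *\<^sub>R bracket3 (f p) (partial_x f p) (partial_y f p)"
proof -
  have diff: "f differentiable (at p)" "\<nu> differentiable (at p)"
      "partial_x f differentiable (at p)" "partial_x \<nu> differentiable (at p)" if "p \<in> D" for p
    using assms(1-3) that
    by (auto intro: smooth_on_imp_differentiable smooth_on_imp_partial_x_differentiable)
  have lelieuvre_x: "wedge (f p) (partial_x f p) = hodge_star (wedge (\<nu> p) (partial_x \<nu> p))"
    and lelieuvre_y: "wedge (f p) (partial_y f p) = - hodge_star (wedge (\<nu> p) (partial_y \<nu> p))"
    if "p \<in> D" for p
    using assms(7) that by (auto simp: projective_lelieuvre_on_def)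
  have incidence: "f p \<bullet> \<nu> p = 0" if "p \<in> D" for p
    using assms(6) that by blast
  have fx_\<nu>: "partial_x f p \<bullet> \<nu> p = 0" if "p \<in> D" for p
  proof -
    \<comment> \<open>The right side has a repeated vector and is zero, so the coefficient vanishes
      because f does not.\<close>
    have "(partial_x f p \<bullet> \<nu> p) *\<^sub>R f p = bracket3 (\<nu> p) (partial_x \<nu> p) (\<nu> p)"
      using arg_cong[OF lelieuvre_x[OF that], of "\<lambda>T. T *v \<nu> p"]
      by (simp add: wedge_mult_vector_orthogonal incidence[OF that] hodge_star_wedge_mult_vector)
    then show ?thesis using assms(4) that by (simp add: bracket3_same)
  qed
  have fy_\<nu>: "partial_y f p \<bullet> \<nu> p = 0" if "p \<in> D" for p
  proof -
    have "(partial_y f p \<bullet> \<nu> p) *\<^sub>R f p = - bracket3 (\<nu> p) (partial_y \<nu> p) (\<nu> p)"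
      using arg_cong[OF lelieuvre_y[OF that], of "\<lambda>T. T *v \<nu> p"]
      by (simp add: wedge_mult_vector_orthogonal incidence[OF that] minus_hodge_star_wedge_mult_vector)
    then show ?thesis using assms(4) that by (simp add: bracket3_same)
  qed
  have f_\<nu>x: "f p \<bullet> partial_x \<nu> p = 0" if "p \<in> D" for p
    using partial_x_inner_eq_0[OF assms(1) that incidence diff(1,2)[OF that]] fx_\<nu>[OF that] by simp
  have f_\<nu>y: "f p \<bullet> partial_y \<nu> p = 0" if "p \<in> D" for p
    using partial_y_inner_eq_0[OF assms(1) that incidence diff(1,2)[OF that]] fy_\<nu>[OF that] by simp
  \<comment> \<open>The common square root, given without extracting a root: the map itself selects
    its sign at each point.\<close>
  define s where "s p = partial_x f p \<bullet> partial_y \<nu> p" for p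
  have bracket_\<nu>: "bracket3 (\<nu> p) (partial_x \<nu> p) (partial_y \<nu> p) = s p *\<^sub>R f p" if "p \<in> D" for p
    using arg_cong[OF lelieuvre_x[OF that], of "\<lambda>T. T *v partial_y \<nu> p"]
    by (simp add: s_def wedge_mult_vector_orthogonal f_\<nu>y[OF that] hodge_star_wedge_mult_vector)
  have fy_\<nu>x: "partial_y f p \<bullet> partial_x \<nu> p = s p" if "p \<in> D" for p
  proof -
    \<comment> \<open>The minus sign of the y-equation cancels the one from exchanging
      \<open>partial_x \<nu> p\<close> and \<open>partial_y \<nu> p\<close> in the bracket.\<close>
    have "(partial_y f p \<bullet> partial_x \<nu> p) *\<^sub>R f p = s p *\<^sub>R f p"
      using arg_cong[OF lelieuvre_y[OF that], of "\<lambda>T. T *v partial_x \<nu> p"]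
      by (simp add: wedge_mult_vector_orthogonal f_\<nu>x[OF that] minus_hodge_star_wedge_mult_vector
          bracket3_swap[of _ "partial_y \<nu> p"] bracket_\<nu>[OF that])
    then show ?thesis using assms(4) that by simp
  qed
  have bracket_f: "bracket3 (f p) (partial_x f p) (partial_y f p) = s p *\<^sub>R \<nu> p" if "p \<in> D" for p
  proof -
    have "wedge (\<nu> p) (partial_x \<nu> p) = hodge_star (wedge (f p) (partial_x f p))"
      by (simp add: lelieuvre_x[OF that] hodge_star_hodge_star_wedge)
    from arg_cong[OF this, of "\<lambda>T. T *v partial_y f p"] show ?thesis
      using fy_\<nu>[OF that] fy_\<nu>x[OF that]
      by (simp add: wedge_mult_vector_orthogonal hodge_star_wedge_mult_vector inner_commute)
  qed
  have "(s p)\<^sup>2 = det4 (\<nu> p) (partial_x \<nu> p) (partial_y \<nu> p) (partial_y (partial_x \<nu>) p)"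
    "(s p)\<^sup>2 = det4 (f p) (partial_x f p) (partial_y f p) (partial_y (partial_x f) p)"
    if "p \<in> D" for p
  proof -
    have "f p \<bullet> partial_y (partial_x \<nu>) p = - s p"
      using partial_y_inner_eq_0[OF assms(1) that f_\<nu>x diff(1,4)[OF that]] fy_\<nu>x[OF that] by simp
    \<comment> \<open>One factor s comes from the bracket, the other from the inner product with the
      mixed derivative, whose minus sign cancels that of \<open>det4_eq_inner\<close>.\<close>
    then show "(s p)\<^sup>2 = det4 (\<nu> p) (partial_x \<nu> p) (partial_y \<nu> p) (partial_y (partial_x \<nu>) p)"
      by (simp add: det4_eq_inner bracket_\<nu>[OF that] power2_eq_square)
    have "\<nu> p \<bullet> partial_y (partial_x f) p = - s p"
      using partial_y_inner_eq_0[OF assms(1) that fx_\<nu> diff(3,2)[OF that]]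
      by (simp add: s_def inner_commute)
    then show "(s p)\<^sup>2 = det4 (f p) (partial_x f p) (partial_y f p) (partial_y (partial_x f) p)"
      by (simp add: det4_eq_inner bracket_f[OF that] power2_eq_square)
  qed
  moreover from this(1) have "s p \<noteq> 0" if "p \<in> D" for p
    using assms(8) that by fastforce
  \<comment> \<open>The same s serves as witness for both roots; being nonzero, it can be divided
    out of the two bracket identities.\<close>
  ultimately show ?thesis
    by (intro exI[of _ s]) (simp add: bracket_\<nu> bracket_f)
qed

end
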